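(* Let $c_0,c_h>0$ be constants, and let $\mathbf{A}(t,\mathbf{x})\in\mathbb{R}^3$ and $Z(t,\mathbf{x})\in\mathbb{R}$ be smooth fields of $t\in\mathbb{R}$, $\mathbf{x}\in\mathbb{R}^3$. Define $$\mathbf{E}=-\frac1{c_0}\partial_t\mathbf{A},\qquad \phi=-\frac1{c_h}\partial_t Z,\qquad \mathbf{B}=\nabla\times\mathbf{A}+\nabla Z,\qquad \psi=\frac{c_h}{c_0}\nabla\cdot\mathbf{A}.$$ Suppose $(\mathbf{A},Z)$ satisfies the Euler--Lagrange equations (with respect to $\mathbf{A}$ and $Z$) of the action $S[\mathbf{A},Z]=\int\Lambda\,\mathrm{d}\mathbf{x}\,\mathrm{d}t$ with Lagrangian density $$\Lambda=\frac12\left[\frac1{c_0^2}|\partial_t\mathbf{A}|^2-|\nabla\times\mathbf{A}|^2-\frac{c_h^2}{c_0^2}(\nabla\cdot\mathbf{A})^2+\frac1{c_h^2}(\partial_t Z)^2-|\nabla Z|^2\right].$$ Then $(\mathbf{B},\phi,\mathbf{E},\psi)$ satisfies the Maxwell-GLM system $$\partial_t\mathbf{B}+c_0\nabla\times\mathbf{E}+c_h\nabla\phi=0,\qquad \partial_t\phi+c_h\nabla\cdot\mathbf{B}=0,$$ $$\partial_t\mathbf{E}-c_0\nabla\times\mathbf{B}+c_h\nabla\psi=0,\qquad \partial_t\psi+c_h\nabla\cdot\mathbf{E}=0.$$ More precisely, the equations for $\mathbf{B}$ and $\psi$ follow from the definitions alone, while the equation for $\phi$ is the Euler--Lagrange equation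 with respect to $Z$ and the equation for $\mathbf{E}$ is the Euler--Lagrange equation with respect to $\mathbf{A}$.
   Context: For a Lagrangian density depending on fields $u$ through $u$, $\partial_t u$, $\partial_k u$, the Euler--Lagrange equations are $-\partial_t\frac{\partial\Lambda}{\partial(\partial_t u)}-\sum_k\partial_k\frac{\partial\Lambda}{\partial(\partial_k u)}+\frac{\partial\Lambda}{\partial u}=0$ for each scalar component $u$ ($u=A_i$, $i=1,2,3$, and $u=Z$). *)

theory Defs
  imports "HOL-Analysis.Analysis"
begin

section \<open>Smooth maps and differential operators\<close>

primrec C_diff :: "nat \<Rightarrow> ('a::euclidean_space \<Rightarrow> 'b::real_normed_vector) \<Rightarrow> bool" where
  "C_diff 0 f \<longleftrightarrow> continuous_on UNIV f"
| "C_diff (Suc n) f \<longleftrightarrow>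
     (\<forall>p. f differentiable (at p)) \<and> (\<forall>v. C_diff n (\<lambda>p. frechet_derivative f (at p) v))"

definition smooth :: "('a::euclidean_space \<Rightarrow> 'b::real_normed_vector) \<Rightarrow> bool" where
  "smooth f \<longleftrightarrow> (\<forall>n. C_diff n f)"

type_synonym 'v field = "real \<Rightarrow> real^3 \<Rightarrow> 'v"

definition dt :: "('v::real_normed_vector) field \<Rightarrow> 'v field" where
  "dt f t x = vector_derivative (\<lambda>s. f s x) (at t)"

definition dx :: "3 \<Rightarrow> ('v::real_normed_vector) field \<Rightarrow> 'v field" where
  "dx k f t x = vector_derivative (\<lambda>s. f t (x + s *\<^sub>R axis k 1)) (at 0)"

text \<open>The matrix \<open>G\<close> stands for \<open>G k i = \<partial>\<^sub>k F\<^sub>i\<close>. The curl and divergence are algebraic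
  functions of it; the Lagrangian density uses these same functions with the entries of \<open>G\<close>
  as independent variables.\<close>

definition curl_of :: "(3 \<Rightarrow> 3 \<Rightarrow> real) \<Rightarrow> real^3" where
  "curl_of G = vector [G 2 3 - G 3 2, G 3 1 - G 1 3, G 1 2 - G 2 1]"

definition div_of :: "(3 \<Rightarrow> 3 \<Rightarrow> real) \<Rightarrow> real" where
  "div_of G = (\<Sum>i\<in>UNIV. G i i)"

definition grad :: "real field \<Rightarrow> (real^3) field" where
  "grad f t x = (\<chi> k. dx k f t x)"

definition curl :: "(real^3) field \<Rightarrow> (real^3) field" where
  "curl F t x = curl_of (\<lambda>k i. dx k (\<lambda>s y. F s y $ i) t x)"

definition diverg :: "(real^3) field \<Rightarrow> real field" where
  "diverg F t x = div_of (\<lambda>k i. dx k (\<lambda>s y. F s y $ i) t x)"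


section \<open>Euler--Lagrange equations of a first-order Lagrangian density\<close>

text \<open>A density is a function \<open>L q v w\<close> of independent real variables, for scalar field
  components indexed by \<open>'i\<close>: \<open>q i\<close> for \<open>u\<^sub>i\<close>, \<open>v i\<close> for \<open>\<partial>\<^sub>t u\<^sub>i\<close> and
  \<open>w k i\<close> for \<open>\<partial>\<^sub>k u\<^sub>i\<close>.\<close>

type_synonym 'i density = "('i \<Rightarrow> real) \<Rightarrow> ('i \<Rightarrow> real) \<Rightarrow> (3 \<Rightarrow> 'i \<Rightarrow> real) \<Rightarrow> real"

definition dL_u :: "'i \<Rightarrow> 'i density \<Rightarrow> 'i density" where
  "dL_u i L q v w = deriv (\<lambda>r. L (q(i := r)) v w) (q i)"

definition dL_ut :: "'i \<Rightarrow> 'i density \<Rightarrow> 'i density" where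
  "dL_ut i L q v w = deriv (\<lambda>r. L q (v(i := r)) w) (v i)"

definition dL_ux :: "3 \<Rightarrow> 'i \<Rightarrow> 'i density \<Rightarrow> 'i density" where
  "dL_ux k i L q v w = deriv (\<lambda>r. L q v (w(k := (w k)(i := r)))) (w k i)"

definition along :: "'i density \<Rightarrow> ('i \<Rightarrow> real field) \<Rightarrow> real field" where
  "along L u t x = L (\<lambda>i. u i t x) (\<lambda>i. dt (u i) t x) (\<lambda>k i. dx k (u i) t x)"

definition euler_lagrange :: "'i density \<Rightarrow> ('i \<Rightarrow> real field) \<Rightarrow> 'i \<Rightarrow> real field" where
  "euler_lagrange L u i t x =
     - dt (along (dL_ut i L) u) t x
     - (\<Sum>k\<in>UNIV. dx k (along (dL_ux k i L) u) t x)
     + along (dL_u i L) u t x"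


section \<open>The Maxwell-GLM Lagrangian\<close>

datatype component = CompA "3" | CompZ

fun glm_fields :: "(real^3) field \<Rightarrow> real field \<Rightarrow> component \<Rightarrow> real field" where
  "glm_fields A Z (CompA i) = (\<lambda>t x. A t x $ i)"
| "glm_fields A Z CompZ = Z"

definition glm_density :: "real \<Rightarrow> real \<Rightarrow> component density" where
  "glm_density c0 ch q v w =
     1/2 * (1 / c0\<^sup>2 * (norm (\<chi> i. v (CompA i)))\<^sup>2
            - (norm (curl_of (\<lambda>k i. w k (CompA i))))\<^sup>2
            - ch\<^sup>2 / c0\<^sup>2 * (div_of (\<lambda>k i. w k (CompA i)))\<^sup>2
            + 1 / ch\<^sup>2 * (v CompZ)\<^sup>2
            - (norm (\<chi> k. w k CompZ))\<^sup>2)"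

lemma glm_density_along:
  assumes "smooth (\<lambda>(t, x). A t x)"
  shows "along (glm_density c0 ch) (glm_fields A Z) t x =
     1/2 * (1 / c0\<^sup>2 * (norm (dt A t x))\<^sup>2 - (norm (curl A t x))\<^sup>2
            - ch\<^sup>2 / c0\<^sup>2 * (diverg A t x)\<^sup>2
            + 1 / ch\<^sup>2 * (dt Z t x)\<^sup>2 - (norm (grad Z t x))\<^sup>2)"
proof -
  have "C_diff (Suc 0) (\<lambda>(t, x). A t x)"
    using assms unfolding smooth_def by blast
  then have "(\<lambda>(t, x). A t x) differentiable (at (t, x))"
    by simp
  moreover have "(\<lambda>s. (s, x)) differentiable (at t)"
    by (auto simp: differentiable_def intro!: exI derivative_eq_intros)
  ultimately have "((\<lambda>(t, x). A t x) \<circ> (\<lambda>s. (s, x))) differentiable (at t)"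
    by (intro differentiable_chain_at) auto
  then have "(\<lambda>s. A s x) differentiable (at t)"
    by (simp add: o_def)
  then have "((\<lambda>s. A s x) has_vector_derivative dt A t x) (at t)"
    unfolding dt_def by (simp add: vector_derivative_works)
  then have "((\<lambda>s. A s x $ i) has_vector_derivative (dt A t x $ i)) (at t)" for i
    by (rule bounded_linear.has_vector_derivative[OF bounded_linear_vec_nth])
  then have "dt (\<lambda>s y. A s y $ i) t x = dt A t x $ i" for i
    unfolding dt_def[of "\<lambda>s y. A s y $ i"] by (rule vector_derivative_at)
  then have "(\<chi> i. dt (\<lambda>s y. A s y $ i) t x) = dt A t x"
    by (simp add: vec_eq_iff)
  then show ?thesis
    by (simp add: along_def glm_density_def curl_def diverg_def grad_def)
qed

end

theory Submission
  imports Defs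
begin

text \<open>
  The Lagrangian density is a quadratic form in the first derivatives of \<open>A\<close> and \<open>Z\<close>, so its
  partial derivatives are linear in them and the Euler--Lagrange equations are linear wave
  equations with constant coefficients: for \<open>Z\<close> the equation is
  \<open>- (1/ch\<^sup>2) \<partial>\<^sub>t\<^sup>2 Z + \<Delta> Z = 0\<close>, and for \<open>A\<close> it is
  \<open>- (1/c0\<^sup>2) \<partial>\<^sub>t\<^sup>2 A - curl (curl A) + (ch\<^sup>2/c0\<^sup>2) grad (div A) = 0\<close>.

  Inserting the definitions of \<open>E, phi, B, psi\<close> into the system, the left-hand sides of the
  equations for \<open>phi\<close> and \<open>E\<close> become exactly \<open>ch\<close> and \<open>c0\<close> times these two expressions, because
  the cross terms \<open>div (curl A)\<close> and \<open>curl (grad Z)\<close> vanish; since \<open>ch\<close> and \<open>c0\<close> are nonzero, this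
  gives the two equivalences. The left-hand sides of the equations for \<open>B\<close> and \<open>psi\<close> vanish
  identically, because \<open>\<partial>\<^sub>t\<close> commutes with \<open>curl\<close>, \<open>grad\<close> and \<open>div\<close>.

  Every cancellation is therefore an instance of the symmetry of second derivatives,
  \<open>frechet_derivative_commute\<close>, carried over to fields in \<open>dx_dt_commute\<close> and \<open>dx_commute\<close>.
  The lemmas \<open>dL_ut_glm_A\<close>, \<open>dL_ut_glm_Z\<close>, \<open>dL_ux_glm_A\<close> and \<open>dL_ux_glm_Z\<close> supply the partial
  derivatives of the density. What remains is linear algebra in the components.
\<close>

section \<open>Smooth maps and symmetry of second derivatives\<close>

lemma smooth_differentiable:
  assumes "smooth f"
  shows "f differentiable (at p)"
proof -
  have "C_diff (Suc 0) f"
    using assms unfolding smooth_def by blast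
  then show ?thesis by simp
qed

lemma smooth_frechet_derivative:
  assumes "smooth f"
  shows "smooth (\<lambda>p. frechet_derivative f (at p) v)"
  unfolding smooth_def
proof
  fix n
  have "C_diff (Suc n) f"
    using assms unfolding smooth_def by blast
  then show "C_diff n (\<lambda>p. frechet_derivative f (at p) v)" by simp
qed

lemma smooth_continuous:
  assumes "smooth f"
  shows "isCont f p"
  using assms differentiable_imp_continuous_within smooth_differentiable by blast

lemma C_diff_vec_nth:
  fixes f :: "'a::euclidean_space \<Rightarrow> real^'n"
  shows "C_diff n f \<Longrightarrow> C_diff n (\<lambda>p. f p $ i)"
proof (induction n arbitrary: f)
  case 0
  then show ?case by (simp add: continuous_on_component)
next
  case (Suc n)
  have "((\<lambda>p. f p $ i) has_derivative (\<lambda>v. frechet_derivative f (at p) v $ i)) (at p)" for p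
    using Suc.prems
    by (intro bounded_linear.has_derivative[OF bounded_linear_vec_nth])
       (simp add: frechet_derivative_works[symmetric])
  moreover from this
  have "frechet_derivative (\<lambda>p. f p $ i) (at p) = (\<lambda>v. frechet_derivative f (at p) v $ i)" for p
    by (rule frechet_derivative_at[symmetric])
  ultimately show ?case
    using Suc by (auto simp: differentiable_def)
qed

lemma smooth_vec_nth:
  fixes f :: "'a::euclidean_space \<Rightarrow> real^'n"
  shows "smooth f \<Longrightarrow> smooth (\<lambda>p. f p $ i)"
  by (simp add: smooth_def C_diff_vec_nth)

lemma has_real_derivative_along_line:
  fixes f :: "'a::euclidean_space \<Rightarrow> real"
  assumes "f differentiable (at (q + s *\<^sub>R v))"
  shows "((\<lambda>s. f (q + s *\<^sub>R v)) has_real_derivative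
           frechet_derivative f (at (q + s *\<^sub>R v)) v) (at s)"
proof -
  let ?D = "frechet_derivative f (at (q + s *\<^sub>R v))"
  have D: "(f has_derivative ?D) (at (q + s *\<^sub>R v))"
    using assms frechet_derivative_works by blast
  have "((\<lambda>s. q + s *\<^sub>R v) has_derivative (\<lambda>h. h *\<^sub>R v)) (at s)"
    by (auto intro!: derivative_eq_intros)
  from diff_chain_at[OF this D]
  have "((\<lambda>s. f (q + s *\<^sub>R v)) has_derivative (\<lambda>h. ?D (h *\<^sub>R v))) (at s)"
    by (simp add: o_def)
  moreover have "(\<lambda>h. ?D (h *\<^sub>R v)) = (*) (?D v)"
    using has_derivative_bounded_linear[OF D]
    by (auto simp: linear_simps)
  ultimately show ?thesis
    by (simp add: has_field_derivative_def)
qed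

text \<open>The second difference is a difference in the direction \<open>v\<close> of the function
  \<open>q \<mapsto> f (q + h w) - f q\<close>. One application of the mean value theorem in the direction \<open>v\<close> turns
  it into a difference of \<open>\<partial>\<^sub>v f\<close> in the direction \<open>w\<close>, and a second one into \<open>\<partial>\<^sub>w \<partial>\<^sub>v f\<close>.\<close>

lemma second_difference_mvt:
  fixes f :: "'a::euclidean_space \<Rightarrow> real"
  assumes "smooth f" and "h > 0"
  obtains r s where "0 < r" "r < h" "0 < s" "s < h"
    "f (p + h *\<^sub>R v + h *\<^sub>R w) - f (p + h *\<^sub>R v) - f (p + h *\<^sub>R w) + f p =
      h * h * frechet_derivative (\<lambda>q. frechet_derivative f (at q) v) (at (p + r *\<^sub>R v + s *\<^sub>R w)) w"
proof -
  let ?Dv = "\<lambda>q. frechet_derivative f (at q) v"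
  let ?g = "\<lambda>r. f ((p + h *\<^sub>R w) + r *\<^sub>R v) - f (p + r *\<^sub>R v)"
  have g: "DERIV ?g r :> ?Dv ((p + h *\<^sub>R w) + r *\<^sub>R v) - ?Dv (p + r *\<^sub>R v)" for r
    by (intro DERIV_diff has_real_derivative_along_line smooth_differentiable assms)
  obtain r where r: "0 < r" "r < h"
    "?g h - ?g 0 = (h - 0) * (?Dv ((p + h *\<^sub>R w) + r *\<^sub>R v) - ?Dv (p + r *\<^sub>R v))"
    using MVT2[of 0 h ?g, OF \<open>h > 0\<close> g] by blast
  have k: "DERIV (\<lambda>s. ?Dv ((p + r *\<^sub>R v) + s *\<^sub>R w)) s :>
      frechet_derivative ?Dv (at ((p + r *\<^sub>R v) + s *\<^sub>R w)) w" for s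
    by (intro has_real_derivative_along_line smooth_differentiable smooth_frechet_derivative assms)
  obtain s where s: "0 < s" "s < h"
    "?Dv ((p + r *\<^sub>R v) + h *\<^sub>R w) - ?Dv ((p + r *\<^sub>R v) + 0 *\<^sub>R w) =
      (h - 0) * frechet_derivative ?Dv (at ((p + r *\<^sub>R v) + s *\<^sub>R w)) w"
    using MVT2[of 0 h "\<lambda>s. ?Dv ((p + r *\<^sub>R v) + s *\<^sub>R w)", OF \<open>h > 0\<close> k] by blast
  show thesis
    using r s by (intro that[of r s]) (simp_all add: algebra_simps)
qed

text \<open>Schwarz's theorem. The second difference is symmetric in \<open>v\<close> and \<open>w\<close>, so by
  \<open>second_difference_mvt\<close> the two mixed derivatives agree at a pair of points, each within
  \<open>O(h)\<close> of \<open>p\<close>. Letting \<open>h\<close> tend to \<open>0\<close>, continuity makes them agree at \<open>p\<close>.\<close>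

lemma frechet_derivative_commute:
  fixes f :: "'a::euclidean_space \<Rightarrow> real"
  assumes "smooth f"
  shows "frechet_derivative (\<lambda>q. frechet_derivative f (at q) v) (at p) w =
         frechet_derivative (\<lambda>q. frechet_derivative f (at q) w) (at p) v"
proof -
  let ?D = "\<lambda>v w q. frechet_derivative (\<lambda>q. frechet_derivative f (at q) v) (at q) w"
  define h where "h n = 1 / real (Suc n)" for n
  have h0: "h n > 0" for n by (simp add: h_def)
  have hlim: "h \<longlonglongrightarrow> 0"
    unfolding h_def using LIMSEQ_inverse_real_of_nat by (simp add: inverse_eq_divide)
  have "\<exists>r s r' s'. 0 < r \<and> r < h n \<and> 0 < s \<and> s < h n \<and> 0 < r' \<and> r' < h n \<and> 0 < s' \<and> s' < h n \<and>
      ?D v w (p + r *\<^sub>R v + s *\<^sub>R w) = ?D w v (p + r' *\<^sub>R w + s' *\<^sub>R v)" for n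
  proof -
    obtain r s where 1: "0 < r" "r < h n" "0 < s" "s < h n"
      "f (p + h n *\<^sub>R v + h n *\<^sub>R w) - f (p + h n *\<^sub>R v) - f (p + h n *\<^sub>R w) + f p =
        h n * h n * ?D v w (p + r *\<^sub>R v + s *\<^sub>R w)"
      using second_difference_mvt[OF assms h0] by metis
    obtain r' s' where 2: "0 < r'" "r' < h n" "0 < s'" "s' < h n"
      "f (p + h n *\<^sub>R w + h n *\<^sub>R v) - f (p + h n *\<^sub>R w) - f (p + h n *\<^sub>R v) + f p =
        h n * h n * ?D w v (p + r' *\<^sub>R w + s' *\<^sub>R v)"
      using second_difference_mvt[OF assms h0] by metis
    have swap: "p + h n *\<^sub>R w + h n *\<^sub>R v = p + h n *\<^sub>R v + h n *\<^sub>R w"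
      by (simp add: add_ac)
    have "h n * h n * ?D v w (p + r *\<^sub>R v + s *\<^sub>R w) = h n * h n * ?D w v (p + r' *\<^sub>R w + s' *\<^sub>R v)"
      using 1(5) 2(5) by (simp only: swap)
    then have "?D v w (p + r *\<^sub>R v + s *\<^sub>R w) = ?D w v (p + r' *\<^sub>R w + s' *\<^sub>R v)"
      using h0[of n] by simp
    then show ?thesis using 1 2 by blast
  qed
  then obtain r s r' s' where
    b: "\<And>n. 0 < r n" "\<And>n. r n < h n" "\<And>n. 0 < s n" "\<And>n. s n < h n"
       "\<And>n. 0 < r' n" "\<And>n. r' n < h n" "\<And>n. 0 < s' n" "\<And>n. s' n < h n" and
    eq: "\<And>n. ?D v w (p + r n *\<^sub>R v + s n *\<^sub>R w) = ?D w v (p + r' n *\<^sub>R w + s' n *\<^sub>R v)"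
    by metis
  have squeeze: "a \<longlonglongrightarrow> 0" if "\<And>n. 0 < a n" "\<And>n. a n < h n" for a :: "nat \<Rightarrow> real"
    by (rule tendsto_sandwich[OF _ _ tendsto_const hlim]) (simp_all add: less_imp_le that)
  have lim: "(\<lambda>n. ?D v w (p + r n *\<^sub>R v + s n *\<^sub>R w)) \<longlonglongrightarrow> ?D v w p"
    if "r \<longlonglongrightarrow> 0" "s \<longlonglongrightarrow> 0" for r s v w
  proof (rule isCont_tendsto_compose[of p "?D v w"])
    show "isCont (?D v w) p"
      by (intro smooth_continuous smooth_frechet_derivative assms)
    have "(\<lambda>n. p + r n *\<^sub>R v + s n *\<^sub>R w) \<longlonglongrightarrow> p + 0 *\<^sub>R v + 0 *\<^sub>R w"
      by (intro tendsto_intros that)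
    then show "(\<lambda>n. p + r n *\<^sub>R v + s n *\<^sub>R w) \<longlonglongrightarrow> p" by simp
  qed
  have "(\<lambda>n. ?D v w (p + r n *\<^sub>R v + s n *\<^sub>R w)) \<longlonglongrightarrow> ?D v w p"
    by (intro lim squeeze b)
  moreover have "(\<lambda>n. ?D v w (p + r n *\<^sub>R v + s n *\<^sub>R w)) \<longlonglongrightarrow> ?D w v p"
    unfolding eq by (intro lim squeeze b)
  ultimately show ?thesis by (rule LIMSEQ_unique)
qed


section \<open>Partial derivatives of space-time fields\<close>

text \<open>Joint (Frechet) differentiability in \<open>(t, x)\<close>. It serves as the side condition of the
  linearity rules for \<open>dt\<close> and \<open>dx\<close> and, unlike the existence of a single partial derivative,
  covers all four directions at once.\<close>

definition differentiable_field :: "'v::real_normed_vector field \<Rightarrow> bool" where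
  "differentiable_field f \<longleftrightarrow> (\<forall>p. (\<lambda>(t, x). f t x) differentiable (at p))"

lemma smooth_differentiable_field:
  "smooth (\<lambda>(t, x). f t x) \<Longrightarrow> differentiable_field f"
  by (simp add: differentiable_field_def smooth_differentiable)

lemma has_vector_derivative_frechet_dt:
  assumes "differentiable_field f"
  shows "((\<lambda>s. f s x) has_vector_derivative
           frechet_derivative (\<lambda>(t, x). f t x) (at (t, x)) (1, 0)) (at t)"
proof -
  let ?D = "frechet_derivative (\<lambda>(t, x). f t x) (at (t, x))"
  have D: "((\<lambda>(t, x). f t x) has_derivative ?D) (at (t, x))"
    using assms frechet_derivative_works unfolding differentiable_field_def by blast
  have "((\<lambda>s. (s, x)) has_derivative (\<lambda>h. (h, 0))) (at t)"
    by (intro has_derivative_Pair has_derivative_ident has_derivative_const)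
  from diff_chain_at[OF this D]
  have "((\<lambda>s. f s x) has_derivative (\<lambda>h. ?D (h, 0))) (at t)"
    by (simp add: o_def)
  moreover have "(\<lambda>h. ?D (h, 0)) = (\<lambda>h. h *\<^sub>R ?D (1, 0))"
    using linear_scale[OF has_derivative_linear[OF D], of _ "(1, 0)"]
    by (intro ext) (metis mult.right_neutral real_scaleR_def scaleR_Pair scaleR_zero_right)
  ultimately show ?thesis
    unfolding has_vector_derivative_def by simp
qed

lemma has_vector_derivative_frechet_dx:
  assumes "differentiable_field f"
  shows "((\<lambda>s. f t (x + s *\<^sub>R axis k 1)) has_vector_derivative
           frechet_derivative (\<lambda>(t, x). f t x) (at (t, x)) (0, axis k 1)) (at 0)"
proof -
  let ?D = "frechet_derivative (\<lambda>(t, x). f t x) (at (t, x))"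
  have D: "((\<lambda>(t, x). f t x) has_derivative ?D) (at (t, x))"
    using assms frechet_derivative_works unfolding differentiable_field_def by blast
  have "((\<lambda>s. (t, x + s *\<^sub>R axis k 1)) has_derivative (\<lambda>h. (0, h *\<^sub>R axis k 1))) (at (0::real))"
    by (rule has_derivative_eq_rhs, (rule derivative_intros)+) simp
  from diff_chain_at[OF this, of "\<lambda>(t, x). f t x" ?D] D
  have "((\<lambda>s. f t (x + s *\<^sub>R axis k 1)) has_derivative (\<lambda>h. ?D (0, h *\<^sub>R axis k 1))) (at 0)"
    by (simp add: o_def)
  moreover have "?D (0, h *\<^sub>R axis k 1) = h *\<^sub>R ?D (0, axis k 1)" for h
    using linear_scale[OF has_derivative_linear[OF D], of h "(0, axis k 1)"] by simp
  ultimately show ?thesis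
    by (simp add: has_vector_derivative_def)
qed

lemma dt_eq_frechet:
  "differentiable_field f \<Longrightarrow>
     dt f t x = frechet_derivative (\<lambda>(t, x). f t x) (at (t, x)) (1, 0)"
  unfolding dt_def by (rule vector_derivative_at[OF has_vector_derivative_frechet_dt])

lemma dx_eq_frechet:
  "differentiable_field f \<Longrightarrow>
     dx k f t x = frechet_derivative (\<lambda>(t, x). f t x) (at (t, x)) (0, axis k 1)"
  unfolding dx_def by (rule vector_derivative_at[OF has_vector_derivative_frechet_dx])

lemma has_vector_derivative_dt:
  "differentiable_field f \<Longrightarrow> ((\<lambda>s. f s x) has_vector_derivative dt f t x) (at t)"
  by (simp add: dt_eq_frechet has_vector_derivative_frechet_dt)

lemma has_vector_derivative_dx:
  "differentiable_field f \<Longrightarrow>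
     ((\<lambda>s. f t (x + s *\<^sub>R axis k 1)) has_vector_derivative dx k f t x) (at 0)"
  by (simp add: dx_eq_frechet has_vector_derivative_frechet_dx)

lemma smooth_dt:
  assumes "smooth (\<lambda>(t, x). f t x)"
  shows "smooth (\<lambda>(t, x). dt f t x)"
  using smooth_frechet_derivative[OF assms, of "(1, 0)"]
  by (simp add: dt_eq_frechet[OF smooth_differentiable_field[OF assms]] case_prod_unfold)

lemma smooth_dx:
  assumes "smooth (\<lambda>(t, x). f t x)"
  shows "smooth (\<lambda>(t, x). dx k f t x)"
  using smooth_frechet_derivative[OF assms, of "(0, axis k 1)"]
  by (simp add: dx_eq_frechet[OF smooth_differentiable_field[OF assms]] case_prod_unfold)

lemma dx_dt_commute:
  fixes f :: "real field"
  assumes "smooth (\<lambda>(t, x). f t x)"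
  shows "dx k (dt f) t x = dt (dx k f) t x"
proof -
  note df = smooth_differentiable_field[OF assms]
  have "(\<lambda>(t, x). dt f t x) = (\<lambda>q. frechet_derivative (\<lambda>(t, x). f t x) (at q) (1, 0))"
    "(\<lambda>(t, x). dx k f t x) = (\<lambda>q. frechet_derivative (\<lambda>(t, x). f t x) (at q) (0, axis k 1))"
    by (auto simp: dt_eq_frechet[OF df] dx_eq_frechet[OF df])
  then show ?thesis
    unfolding dx_eq_frechet[OF smooth_differentiable_field[OF smooth_dt[OF assms]]]
      dt_eq_frechet[OF smooth_differentiable_field[OF smooth_dx[OF assms]]]
    by (simp only: frechet_derivative_commute[OF assms])
qed

lemma dx_commute:
  fixes f :: "real field"
  assumes "smooth (\<lambda>(t, x). f t x)"
  shows "dx k (dx j f) t x = dx j (dx k f) t x"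
proof -
  note df = smooth_differentiable_field[OF assms]
  have "(\<lambda>(t, x). dx k f t x) = (\<lambda>q. frechet_derivative (\<lambda>(t, x). f t x) (at q) (0, axis k 1))" for k
    by (auto simp: dx_eq_frechet[OF df])
  then show ?thesis
    unfolding dx_eq_frechet[OF smooth_differentiable_field[OF smooth_dx[OF assms]]]
    by (simp only: frechet_derivative_commute[OF assms])
qed

lemma differentiable_field_linear:
  fixes f g :: "real field"
  assumes "differentiable_field f"
  shows "differentiable_field (\<lambda>t x. c * f t x)"
    and "differentiable_field g \<Longrightarrow> differentiable_field (\<lambda>t x. f t x + g t x)"
    and "differentiable_field g \<Longrightarrow> differentiable_field (\<lambda>t x. f t x - g t x)"
    and "differentiable_field (\<lambda>t x. - f t x)"
    and "differentiable_field (\<lambda>t x. f t x / c)"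
  using assms by (auto simp: differentiable_field_def case_prod_unfold divide_inverse)

lemma dt_linear:
  fixes f g :: "real field"
  assumes "differentiable_field f"
  shows "dt (\<lambda>t x. c * f t x) t x = c * dt f t x"
    and "differentiable_field g \<Longrightarrow> dt (\<lambda>t x. f t x + g t x) t x = dt f t x + dt g t x"
    and "differentiable_field g \<Longrightarrow> dt (\<lambda>t x. f t x - g t x) t x = dt f t x - dt g t x"
    and "dt (\<lambda>t x. - f t x) t x = - dt f t x"
    and "dt (\<lambda>t x. f t x / c) t x = dt f t x / c"
proof -
  note f' = has_vector_derivative_dt[OF assms, of x t]
  show "dt (\<lambda>t x. c * f t x) t x = c * dt f t x"
    unfolding dt_def[of "\<lambda>t x. c * f t x"]
    by (rule vector_derivative_at[OF has_vector_derivative_mult_right[OF f']])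
  show "dt (\<lambda>t x. f t x / c) t x = dt f t x / c"
    unfolding dt_def[of "\<lambda>t x. f t x / c"]
    by (rule vector_derivative_at[OF has_vector_derivative_divide[OF f']])
  show "dt (\<lambda>t x. - f t x) t x = - dt f t x"
    unfolding dt_def[of "\<lambda>t x. - f t x"]
    by (rule vector_derivative_at[OF has_vector_derivative_minus[OF f']])
  assume g: "differentiable_field g"
  note g' = has_vector_derivative_dt[OF g, of x t]
  show "dt (\<lambda>t x. f t x + g t x) t x = dt f t x + dt g t x"
    unfolding dt_def[of "\<lambda>t x. f t x + g t x"]
    by (rule vector_derivative_at[OF has_vector_derivative_add[OF f' g']])
  show "dt (\<lambda>t x. f t x - g t x) t x = dt f t x - dt g t x"
    unfolding dt_def[of "\<lambda>t x. f t x - g t x"]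
    by (rule vector_derivative_at[OF has_vector_derivative_diff[OF f' g']])
qed

lemma dx_linear:
  fixes f g :: "real field"
  assumes "differentiable_field f"
  shows "dx k (\<lambda>t x. c * f t x) t x = c * dx k f t x"
    and "differentiable_field g \<Longrightarrow> dx k (\<lambda>t x. f t x + g t x) t x = dx k f t x + dx k g t x"
    and "differentiable_field g \<Longrightarrow> dx k (\<lambda>t x. f t x - g t x) t x = dx k f t x - dx k g t x"
    and "dx k (\<lambda>t x. - f t x) t x = - dx k f t x"
    and "dx k (\<lambda>t x. f t x / c) t x = dx k f t x / c"
proof -
  note f' = has_vector_derivative_dx[OF assms, where t=t and x=x and k=k]
  show "dx k (\<lambda>t x. c * f t x) t x = c * dx k f t x"
    unfolding dx_def[of k "\<lambda>t x. c * f t x"]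
    by (rule vector_derivative_at[OF has_vector_derivative_mult_right[OF f']])
  show "dx k (\<lambda>t x. f t x / c) t x = dx k f t x / c"
    unfolding dx_def[of k "\<lambda>t x. f t x / c"]
    by (rule vector_derivative_at[OF has_vector_derivative_divide[OF f']])
  show "dx k (\<lambda>t x. - f t x) t x = - dx k f t x"
    unfolding dx_def[of k "\<lambda>t x. - f t x"]
    by (rule vector_derivative_at[OF has_vector_derivative_minus[OF f']])
  assume g: "differentiable_field g"
  note g' = has_vector_derivative_dx[OF g, where t=t and x=x and k=k]
  show "dx k (\<lambda>t x. f t x + g t x) t x = dx k f t x + dx k g t x"
    unfolding dx_def[of k "\<lambda>t x. f t x + g t x"]
    by (rule vector_derivative_at[OF has_vector_derivative_add[OF f' g']])
  show "dx k (\<lambda>t x. f t x - g t x) t x = dx k f t x - dx k g t x"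
    unfolding dx_def[of k "\<lambda>t x. f t x - g t x"]
    by (rule vector_derivative_at[OF has_vector_derivative_diff[OF f' g']])
qed

text \<open>The time derivative of a vector field is taken in \<open>real^3\<close>, whereas \<open>curl\<close>, \<open>diverg\<close> and
  \<open>grad\<close> are componentwise. This reduces the whole system to scalar fields.\<close>

lemma dt_vec_nth:
  fixes F :: "(real^3) field"
  assumes "\<And>i. differentiable_field (\<lambda>t x. F t x $ i)"
  shows "dt F t x $ i = dt (\<lambda>t x. F t x $ i) t x"
proof -
  have "((\<lambda>s. F s x) has_vector_derivative (\<chi> i. dt (\<lambda>t x. F t x $ i) t x)) (at t)"
    unfolding has_vector_derivative_def
    by (subst has_derivative_componentwise_within)
       (use has_vector_derivative_dt[OF assms, where x=x and t=t] in
         \<open>auto simp: Basis_vec_def inner_axis has_vector_derivative_def\<close>)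
  then have "dt F t x = (\<chi> i. dt (\<lambda>t x. F t x $ i) t x)"
    unfolding dt_def[of F] by (rule vector_derivative_at)
  then show ?thesis by simp
qed


section \<open>Partial derivatives of the density\<close>

lemma norm_power2_3: "(norm (v::real^3))\<^sup>2 = (v$1)\<^sup>2 + (v$2)\<^sup>2 + (v$3)\<^sup>2"
  unfolding power2_norm_eq_inner by (simp add: inner_vec_def sum_3 power2_eq_square)

text \<open>The coefficients enter as the variables \<open>a, b, e\<close>: as quotients they would be differentiated
  by the quotient rule, which needs nonzero denominators and leaves unreduced fractions.\<close>

lemma glm_density_expand:
  assumes "a = 1 / c0\<^sup>2" and "b = ch\<^sup>2 / c0\<^sup>2" and "e = 1 / ch\<^sup>2"
  shows "glm_density c0 ch q v w =
     1/2 * (a * ((v (CompA 1))\<^sup>2 + (v (CompA 2))\<^sup>2 + (v (CompA 3))\<^sup>2)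
       - ((w 2 (CompA 3) - w 3 (CompA 2))\<^sup>2 + (w 3 (CompA 1) - w 1 (CompA 3))\<^sup>2
          + (w 1 (CompA 2) - w 2 (CompA 1))\<^sup>2)
       - b * (w 1 (CompA 1) + w 2 (CompA 2) + w 3 (CompA 3))\<^sup>2
       + e * (v CompZ)\<^sup>2
       - ((w 1 CompZ)\<^sup>2 + (w 2 CompZ)\<^sup>2 + (w 3 CompZ)\<^sup>2))"
  by (simp add: assms glm_density_def norm_power2_3 curl_of_def div_of_def sum_3)

lemma dL_u_glm: "dL_u i (glm_density c0 ch) q v w = 0"
  by (simp add: dL_u_def glm_density_expand[OF refl refl refl])

lemma dL_ut_glm_A: "dL_ut (CompA i) (glm_density c0 ch) q v w = 1 / c0\<^sup>2 * v (CompA i)"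
proof -
  define a b e where abe: "a = 1 / c0\<^sup>2" "b = ch\<^sup>2 / c0\<^sup>2" "e = 1 / ch\<^sup>2"
  have "i = 1 \<or> i = 2 \<or> i = 3" by (rule exhaust_3)
  then show ?thesis
    unfolding dL_ut_def glm_density_expand[OF abe] abe[symmetric]
    by (elim disjE; hypsubst; intro DERIV_imp_deriv) (auto intro!: derivative_eq_intros)
qed

lemma dL_ut_glm_Z: "dL_ut CompZ (glm_density c0 ch) q v w = 1 / ch\<^sup>2 * v CompZ"
proof -
  define a b e where abe: "a = 1 / c0\<^sup>2" "b = ch\<^sup>2 / c0\<^sup>2" "e = 1 / ch\<^sup>2"
  show ?thesis
    unfolding dL_ut_def glm_density_expand[OF abe] abe[symmetric]
    by (intro DERIV_imp_deriv) (auto intro!: derivative_eq_intros)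
qed

lemma dL_ux_glm_Z: "dL_ux k CompZ (glm_density c0 ch) q v w = - w k CompZ"
proof -
  define a b e where abe: "a = 1 / c0\<^sup>2" "b = ch\<^sup>2 / c0\<^sup>2" "e = 1 / ch\<^sup>2"
  have "k = 1 \<or> k = 2 \<or> k = 3" by (rule exhaust_3)
  then show ?thesis
    unfolding dL_ux_def glm_density_expand[OF abe] abe[symmetric]
    by (elim disjE; hypsubst; intro DERIV_imp_deriv) (auto intro!: derivative_eq_intros)
qed

text \<open>The diagonal entries \<open>w i (CompA i)\<close> occur only in the divergence, and the off-diagonal
  ones only in the curl. There \<open>w k (CompA i)\<close> occurs in a single component, which is
  \<open>w k (CompA i) - w i (CompA k)\<close> up to a sign that the square removes.\<close>

lemma dL_ux_glm_A:
  "dL_ux k (CompA i) (glm_density c0 ch) q v w =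
     (if k = i then - (ch\<^sup>2 / c0\<^sup>2 * (w 1 (CompA 1) + w 2 (CompA 2) + w 3 (CompA 3)))
      else w i (CompA k) - w k (CompA i))"
proof -
  define a b e where abe: "a = 1 / c0\<^sup>2" "b = ch\<^sup>2 / c0\<^sup>2" "e = 1 / ch\<^sup>2"
  have "i = 1 \<or> i = 2 \<or> i = 3" "k = 1 \<or> k = 2 \<or> k = 3" by (rule exhaust_3)+
  then show ?thesis
    unfolding dL_ux_def glm_density_expand[OF abe] abe[symmetric]
    by (elim disjE; hypsubst; intro DERIV_imp_deriv) (auto intro!: derivative_eq_intros)
qed


section \<open>The Maxwell-GLM system\<close>

theorem mainTheorem1:
  fixes c0 ch :: real
    and A E B :: "real \<Rightarrow> real^3 \<Rightarrow> real^3"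
    and Z phi psi :: "real \<Rightarrow> real^3 \<Rightarrow> real"
  assumes "c0 > 0" and "ch > 0"
    and "smooth (\<lambda>(t, x). A t x)" and "smooth (\<lambda>(t, x). Z t x)"
    and "E = (\<lambda>t x. - (1 / c0) *\<^sub>R dt A t x)"
    and "phi = (\<lambda>t x. - (1 / ch) * dt Z t x)"
    and "B = (\<lambda>t x. curl A t x + grad Z t x)"
    and "psi = (\<lambda>t x. ch / c0 * diverg A t x)"
  shows
    "((\<forall>i t x. euler_lagrange (glm_density c0 ch) (glm_fields A Z) i t x = 0) \<longrightarrow>
        (\<forall>t x. dt B t x + c0 *\<^sub>R curl E t x + ch *\<^sub>R grad phi t x = 0) \<and>
        (\<forall>t x. dt phi t x + ch * diverg B t x = 0) \<and>
        (\<forall>t x. dt E t x - c0 *\<^sub>R curl B t x + ch *\<^sub>R grad psi t x = 0) \<and>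
        (\<forall>t x. dt psi t x + ch * diverg E t x = 0)) \<and>
     (\<forall>t x. dt B t x + c0 *\<^sub>R curl E t x + ch *\<^sub>R grad phi t x = 0) \<and>
     (\<forall>t x. dt psi t x + ch * diverg E t x = 0) \<and>
     (\<forall>t x. euler_lagrange (glm_density c0 ch) (glm_fields A Z) CompZ t x = 0 \<longleftrightarrow>
        dt phi t x + ch * diverg B t x = 0) \<and>
     (\<forall>i t x. euler_lagrange (glm_density c0 ch) (glm_fields A Z) (CompA i) t x = 0 \<longleftrightarrow>
        (dt E t x - c0 *\<^sub>R curl B t x + ch *\<^sub>R grad psi t x) $ i = 0)"
proof -
  let ?a = "\<lambda>i t x. A t x $ i"
  let ?L = "glm_density c0 ch" and ?u = "glm_fields A Z"
  have sA: "smooth (\<lambda>(t, x). A t x $ i)" for i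
    using smooth_vec_nth[OF assms(3), of i] by (simp add: case_prod_unfold)
  note sZ = assms(4)
  note sm = sA sZ smooth_dt[OF sA] smooth_dx[OF sA] smooth_dt[OF sZ] smooth_dx[OF sZ]
  note df = sm[THEN smooth_differentiable_field]
  note rules = df differentiable_field_linear dt_linear dx_linear
    dx_dt_commute[OF sA] dx_dt_commute[OF sZ]
  have curlA: "curl A t x $ 1 = dx 2 (?a 3) t x - dx 3 (?a 2) t x"
    "curl A t x $ 2 = dx 3 (?a 1) t x - dx 1 (?a 3) t x"
    "curl A t x $ 3 = dx 1 (?a 2) t x - dx 2 (?a 1) t x" for t x
    by (simp_all add: curl_def curl_of_def)
  have dtA: "dt A t x $ i = dt (?a i) t x" for t x i
    by (rule dt_vec_nth) (rule df)
  have Ei: "E t x $ i = - (1 / c0) * dt (?a i) t x" for t x i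
    by (simp add: assms(5) dtA)
  have Bi: "B t x $ 1 = dx 2 (?a 3) t x - dx 3 (?a 2) t x + dx 1 Z t x"
    "B t x $ 2 = dx 3 (?a 1) t x - dx 1 (?a 3) t x + dx 2 Z t x"
    "B t x $ 3 = dx 1 (?a 2) t x - dx 2 (?a 1) t x + dx 3 Z t x" for t x
    by (simp_all add: assms(7) curlA grad_def)
  have psi: "psi = (\<lambda>t x. ch / c0 * (dx 1 (?a 1) t x + dx 2 (?a 2) t x + dx 3 (?a 3) t x))"
    by (simp add: assms(8) diverg_def div_of_def sum_3)
  have dE: "differentiable_field (\<lambda>t x. E t x $ i)" for i
    unfolding Ei by (intro differentiable_field_linear df)
  have dB: "differentiable_field (\<lambda>t x. B t x $ i)" for i
    using exhaust_3[of i] by (auto simp: Bi rules)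
  have eqB: "dt B t x + c0 *\<^sub>R curl E t x + ch *\<^sub>R grad phi t x = 0" for t x
    using \<open>c0 > 0\<close> \<open>ch > 0\<close>
    by (simp add: vec_eq_iff forall_3 dt_vec_nth[OF dB] Bi curl_def curl_of_def Ei grad_def
        assms(6) rules field_simps)
  have eqpsi: "dt psi t x + ch * diverg E t x = 0" for t x
    using \<open>c0 > 0\<close> \<open>ch > 0\<close>
    by (simp add: psi diverg_def div_of_def Ei sum_3 rules field_simps)
  have along0: "along (dL_u i ?L) ?u = (\<lambda>t x. 0)" for i
    by (intro ext) (simp add: along_def dL_u_glm)
  have alongZ: "along (dL_ut CompZ ?L) ?u = (\<lambda>t x. 1 / ch\<^sup>2 * dt Z t x)"
    "along (dL_ux k CompZ ?L) ?u = (\<lambda>t x. - dx k Z t x)" for k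
    by (intro ext; simp add: along_def dL_ut_glm_Z dL_ux_glm_Z)+
  have alongA: "along (dL_ut (CompA i) ?L) ?u = (\<lambda>t x. 1 / c0\<^sup>2 * dt (?a i) t x)"
    "along (dL_ux k (CompA i) ?L) ?u =
      (if k = i then (\<lambda>t x. - (ch\<^sup>2 / c0\<^sup>2 * (dx 1 (?a 1) t x + dx 2 (?a 2) t x + dx 3 (?a 3) t x)))
       else (\<lambda>t x. dx i (?a k) t x - dx k (?a i) t x))" for i k
    by (intro ext; simp add: along_def dL_ut_glm_A dL_ux_glm_A)+
  have dtE: "dt E t x $ i = - (1 / c0) * dt (dt (?a i)) t x" for t x i
    by (simp add: dt_vec_nth[OF dE] Ei rules)
  \<comment> \<open>\<open>div (curl A) = 0\<close> by \<open>dx_commute\<close>, leaving \<open>ch\<close> times the wave operator applied to \<open>Z\<close>.\<close>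
  have elZ: "dt phi t x + ch * diverg B t x = ch * euler_lagrange ?L ?u CompZ t x" for t x
    using \<open>c0 > 0\<close> \<open>ch > 0\<close>
    by (simp add: euler_lagrange_def alongZ along0 diverg_def div_of_def sum_3 Bi
        assms(6) rules dx_commute[OF sA] dx_commute[OF sZ] field_simps power2_eq_square)
  \<comment> \<open>\<open>curl (grad Z) = 0\<close> by \<open>dx_commute\<close>. The Euler--Lagrange side differentiates the curl and
      divergence entrywise, which gives \<open>- curl (curl A)\<close> and \<open>grad (div A)\<close> row by row.\<close>
  have elA: "(dt E t x - c0 *\<^sub>R curl B t x + ch *\<^sub>R grad psi t x) $ i =
      c0 * euler_lagrange ?L ?u (CompA i) t x" for t x i
  proof -
    have "i = 1 \<or> i = 2 \<or> i = 3" by (rule exhaust_3)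
    then show ?thesis
      using \<open>c0 > 0\<close> \<open>ch > 0\<close>
      by (elim disjE; hypsubst)
         (simp_all add: euler_lagrange_def alongA along0 sum_3 dtE Ei Bi curl_def curl_of_def
           grad_def psi rules dx_commute[OF sA] dx_commute[OF sZ] field_simps power2_eq_square)
  qed
  have eqZ: "euler_lagrange ?L ?u CompZ t x = 0 \<longleftrightarrow> dt phi t x + ch * diverg B t x = 0" for t x
    unfolding elZ using \<open>ch > 0\<close> by simp
  have eqA: "euler_lagrange ?L ?u (CompA i) t x = 0 \<longleftrightarrow>
      (dt E t x - c0 *\<^sub>R curl B t x + ch *\<^sub>R grad psi t x) $ i = 0" for t x i
    unfolding elA using \<open>c0 > 0\<close> by simp
  have "dt E t x - c0 *\<^sub>R curl B t x + ch *\<^sub>R grad psi t x = 0"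
    if "\<forall>i t x. euler_lagrange ?L ?u i t x = 0" for t x
    using that eqA by (simp only: vec_eq_iff zero_index) blast
  then show ?thesis
    using eqB eqpsi eqZ eqA by blast
qed

end
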